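(* Let $\alpha\in[0,1]$, $\beta=\sqrt{1-\alpha^2}$, $c_0>0$, and let $\vec m_{c_0,\alpha}$ be the profile defined in the context. Define $$\vec{\mathrm m}_{c_0,\alpha}(s,t)=\vec m_{c_0,\alpha}\left(\frac{s}{\sqrt t}\right),\qquad s\in\mathbb R,\ t>0.$$ Then: (i) The function $\vec{\mathrm m}_{c_0,\alpha}(\cdot,t)$ is a regular $\mathcal C^\infty(\mathbb R;\mathbb S^2)$-solution, for $t>0$, of the Landau--Lifshitz--Gilbert equation $$\partial_t \vec{\mathrm m}=\beta\,\vec{\mathrm m}\times\vec{\mathrm m}_{ss}-\alpha\,\vec{\mathrm m}\times(\vec{\mathrm m}\times\vec{\mathrm m}_{ss}),\qquad s\in\mathbb R,\ t>0.$$ (ii) There exist unit vectors $\vec A^{\pm}_{c_0,\alpha}=(A^{\pm}_{j,c_0,\alpha})_{j=1}^3\in\mathbb S^2$ such that the following pointwise convergence holds as $t$ goes to zero: $$\lim_{t\to0^+}\vec{\mathrm m}_{c_0,\alpha}(s,t)=\begin{cases}\vec A^+_{c_0,\alpha},&\text{if } s>0,\\ \vec A^-_{c_0,\alpha},&\text{if } s<0,\end{cases}$$ where $\vec A^-_{c_0,\alpha}=(A^+_{1,c_0,\alpha},-A^+_{2,c_0,\alpha},-A^+_{3,c_0,\alpha})$. (iii) Moreover, for every $p\in(1,\infty)$ there exists a constant $C(c_0,\alpha,p)$ such that for all $t>0$ $$\big\|\vec{\mathrm m}_{c_0,\alpha}(\cdot,t)-\vec A^+_{c_0,\alpha}\chi_{(0,\infty)}(\cdot)-\vec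 A^-_{c_0,\alpha}\chi_{(-\infty,0)}(\cdot)\big\|_{L^p(\mathbb R)}\le C(c_0,\alpha,p)\,t^{\frac1{2p}}.$$ In addition, if $\alpha>0$, this estimate also holds for $p=1$.
   Context: $\mathbb S^2$ is the unit sphere in $\mathbb R^3$, $\times$ is the cross product in $\mathbb R^3$, and $\chi_E$ is the characteristic function of a set $E$. The parameters satisfy $\alpha,\beta\in[0,1]$, $\alpha^2+\beta^2=1$. The profile: for $c_0>0$, $\alpha\in[0,1]$, $\{\vec m_{c_0,\alpha},\vec n_{c_0,\alpha},\vec b_{c_0,\alpha}\}$ denotes the unique global solution on $\mathbb R$ (with values in $(\mathbb R^3)^3$; it is automatically smooth and orthonormal) of the Serret--Frenet system $$\vec m'=c\,\vec n,\qquad \vec n'=-c\,\vec m+\tau\,\vec b,\qquad \vec b'=-\tau\,\vec n,$$ with curvature and torsion $c(s)=c_0e^{-\alpha s^2/4}$, $\tau(s)=\beta s/2$, and initial conditions $\vec m(0)=(1,0,0)$, $\vec n(0)=(0,1,0)$, $\vec b(0)=(0,0,1)$. *)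

theory Defs
  imports "HOL-Analysis.Analysis"
begin

definition serret_frenet ::
    "(real \<Rightarrow> real) \<Rightarrow> (real \<Rightarrow> real) \<Rightarrow> (real \<Rightarrow> real^3) \<Rightarrow> (real \<Rightarrow> real^3) \<Rightarrow> (real \<Rightarrow> real^3) \<Rightarrow> bool"
  where "serret_frenet c \<tau> m n b \<longleftrightarrow>
    (\<forall>s. (m has_vector_derivative c s *\<^sub>R n s) (at s) \<and>
         (n has_vector_derivative - c s *\<^sub>R m s + \<tau> s *\<^sub>R b s) (at s) \<and>
         (b has_vector_derivative - \<tau> s *\<^sub>R n s) (at s))"

text \<open>The description below is proper: the system is linear with continuous coefficients, so the
  global solution exists and is unique. The torsion uses \<open>\<beta> = sqrt (1 - \<alpha>\<^sup>2)\<close>.\<close>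

definition profile_frame ::
    "real \<Rightarrow> real \<Rightarrow> (real \<Rightarrow> real^3) \<times> (real \<Rightarrow> real^3) \<times> (real \<Rightarrow> real^3)"
  where "profile_frame c0 \<alpha> = (THE (m, n, b).
    serret_frenet (\<lambda>s. c0 * exp (- \<alpha> * s\<^sup>2 / 4)) (\<lambda>s. sqrt (1 - \<alpha>\<^sup>2) * s / 2) m n b \<and>
    m 0 = vector [1, 0, 0] \<and> n 0 = vector [0, 1, 0] \<and> b 0 = vector [0, 0, 1])"

definition profile :: "real \<Rightarrow> real \<Rightarrow> real \<Rightarrow> real^3"
  where "profile c0 \<alpha> = fst (profile_frame c0 \<alpha>)"

definition self_similar :: "real \<Rightarrow> real \<Rightarrow> real \<Rightarrow> real \<Rightarrow> real^3"
  where "self_similar c0 \<alpha> s t = profile c0 \<alpha> (s / sqrt t)"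

definition vderiv :: "(real \<Rightarrow> 'a::real_normed_vector) \<Rightarrow> real \<Rightarrow> 'a"
  where "vderiv f x = vector_derivative f (at x)"

definition smooth :: "(real \<Rightarrow> 'a::real_normed_vector) \<Rightarrow> bool"
  where "smooth f \<longleftrightarrow> (\<forall>k x. (vderiv ^^ k) f differentiable (at x))"

text \<open>Regular solution for \<open>t > 0\<close>: each time slice is a smooth map into the unit sphere, the
  derivatives occurring in the equation exist classically and are jointly continuous in
  \<open>(s, t)\<close>, and the equation holds pointwise.\<close>

definition regular_LLG_solution :: "real \<Rightarrow> real \<Rightarrow> (real \<Rightarrow> real \<Rightarrow> real^3) \<Rightarrow> bool"
  where "regular_LLG_solution \<alpha> \<beta> u \<longleftrightarrow>
    (\<forall>t>0. smooth (\<lambda>s. u s t) \<and> (\<forall>s. u s t \<in> sphere 0 1)) \<and>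
    (\<forall>s. \<forall>t>0. (\<lambda>\<theta>. u s \<theta>) differentiable (at t)) \<and>
    (\<forall>k\<le>2. continuous_on {(s, t). t > 0} (\<lambda>(s, t). (vderiv ^^ k) (\<lambda>\<sigma>. u \<sigma> t) s)) \<and>
    continuous_on {(s, t). t > 0} (\<lambda>(s, t). vderiv (\<lambda>\<theta>. u s \<theta>) t) \<and>
    (\<forall>s. \<forall>t>0. let m = u s t; m_ss = (vderiv ^^ 2) (\<lambda>\<sigma>. u \<sigma> t) s in
       vderiv (\<lambda>\<theta>. u s \<theta>) t =
         \<beta> *\<^sub>R cross3 m m_ss - \<alpha> *\<^sub>R cross3 m (cross3 m m_ss))"

definition in_Lp :: "real \<Rightarrow> (real \<Rightarrow> 'a::euclidean_space) \<Rightarrow> bool"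
  where "in_Lp p f \<longleftrightarrow>
    f \<in> borel_measurable lborel \<and> integrable lborel (\<lambda>x. norm (f x) powr p)"

text \<open>Meaningful only together with \<^const>\<open>in_Lp\<close>: the Bochner integral of a non-integrable function
  is \<open>0\<close>.\<close>

definition Lp_norm :: "real \<Rightarrow> (real \<Rightarrow> 'a::euclidean_space) \<Rightarrow> real"
  where "Lp_norm p f = (\<integral>x. norm (f x) powr p \<partial>lborel) powr (1 / p)"

definition step_profile :: "real^3 \<Rightarrow> real^3 \<Rightarrow> real \<Rightarrow> real^3"
  where "step_profile A\<^sub>p A\<^sub>m s =
    indicator {0<..} s *\<^sub>R A\<^sub>p + indicator {..<0} s *\<^sub>R A\<^sub>m"

end

theory Submission
  imports Defs
begin

text \<open>
  The solution is the profile \<open>m\<close> viewed at scale \<open>\<surd>t\<close>, so every assertion becomes one about the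
  Serret--Frenet frame \<open>(m, n, b)\<close> with curvature \<open>c s = c\<^sub>0 exp (- \<alpha> s\<^sup>2 / 4)\<close> and torsion
  \<open>\<tau> s = \<beta> s / 2\<close>.

  The frame exists globally because the system is linear (\<open>linear_ode_exists\<close>, by a Dyson series)
  and is unique because the system is skew-symmetric (\<open>serret_frenet_energy\<close>). Uniqueness is then
  used twice more. The triple \<open>(n \<times> b, b \<times> m, m \<times> n)\<close> solves the same initial value problem, so the
  frame is orthonormal and positively oriented; and so does the reversed and rotated frame, so
  \<open>m (- s)\<close> is \<open>m s\<close> with its last two components negated. This gives the relation between the
  limits at \<open>\<infinity>\<close> and at \<open>-\<infinity>\<close>.

  For the equation, \<open>m'' = c' n - c\<^sup>2 m + c \<tau> b\<close>, and the cross products with \<open>m\<close> permute \<open>n\<close> and \<open>b\<close>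
  up to sign. Since \<open>c' = - \<alpha> s c / 2\<close> and \<open>\<alpha>\<^sup>2 + \<beta>\<^sup>2 = 1\<close>, the right-hand side of the
  Landau--Lifshitz--Gilbert equation collapses to \<open>- s c n / 2\<close> (\<open>profile_ode\<close>), which is
  the time derivative of \<open>m (s / \<surd>t)\<close> at \<open>t = 1\<close>.

  The profile converges at infinity with a rate: \<open>\<parallel>m s - A\<parallel> \<le> K / s\<^sup>r\<close>. If \<open>\<alpha> > 0\<close>, the derivative
  \<open>c n\<close> is Gaussian, and \<open>r = 2\<close> is more than enough. If \<open>\<alpha> = 0\<close>, the curvature is constant, but
  \<open>n = - 2 b' / s\<close> oscillates, and integration by parts gives \<open>r = 1\<close>. The difference \<open>f\<close>
  between \<open>m\<close> and the step function with values \<open>A\<close> and \<open>reflect A\<close> is therefore in \<open>L\<^sup>p\<close> as soon as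
  \<open>r p > 1\<close>. The step function is invariant under dilations, so the error at time \<open>t\<close> is
  \<open>f (s / \<surd>t)\<close>, whose \<open>L\<^sup>p\<close> norm is exactly \<open>t powr (1 / (2 p))\<close> times that of \<open>f\<close>.
\<close>

section \<open>Linear differential equations\<close>

lemma ex_primitive_at_0:
  fixes f :: "real \<Rightarrow> 'a::euclidean_space"
  assumes "continuous_on UNIV f"
  shows "\<exists>F. F 0 = 0 \<and> (\<forall>x. (F has_vector_derivative f x) (at x))"
proof -
  have "\<exists>F. \<forall>x::real. (-\<infinity>::ereal) < x \<longrightarrow> x < (\<infinity>::ereal) \<longrightarrow> (F has_vector_derivative f x) (at x)"
    using assms by (intro einterval_antiderivative) (auto simp: continuous_on_eq_continuous_at)
  then obtain F where F: "\<And>x. (F has_vector_derivative f x) (at x)"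
    by auto
  have "((\<lambda>x. F x - F 0) has_vector_derivative f x) (at x)" for x
    using has_vector_derivative_diff[OF F has_vector_derivative_const] by simp
  then show ?thesis
    by (intro exI[of _ "\<lambda>x. F x - F 0"]) simp
qed

text \<open>Integrating a bound \<open>K \<bar>x\<bar>\<^sup>k\<close> gains one power of \<open>\<bar>x\<bar>\<close> and the factor \<open>1 / (k + 1)\<close>; iterated,
  this produces the factorials that make the Dyson series below converge.\<close>

lemma norm_primitive_le_power:
  fixes F :: "real \<Rightarrow> 'a::real_normed_vector"
  assumes "F 0 = 0" and F: "\<And>x. (F has_vector_derivative f x) (at x)"
    and f: "\<And>x. \<bar>x\<bar> < T \<Longrightarrow> norm (f x) \<le> K * \<bar>x\<bar> ^ k" and "\<bar>x\<bar> < T"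
  shows "norm (F x) \<le> K * \<bar>x\<bar> ^ Suc k / real (Suc k)"
proof -
  have pos: "norm (G y) \<le> K * y ^ Suc k / real (Suc k)"
    if G: "G 0 = 0" "\<And>x. (G has_vector_derivative g x) (at x)"
      and g: "\<And>x. \<bar>x\<bar> < T \<Longrightarrow> norm (g x) \<le> K * \<bar>x\<bar> ^ k" and y: "0 < y" "y < T"
    for G :: "real \<Rightarrow> 'a" and g y
  proof -
    have cont: "continuous_on {0..y} G"
      by (meson G(2) continuous_at_imp_continuous_on has_vector_derivative_continuous)
    have "((\<lambda>x. K * x ^ Suc k / real (Suc k)) has_vector_derivative K * x ^ k) (at x)" for x
      unfolding has_real_derivative_iff_has_vector_derivative [symmetric]
      by (rule derivative_eq_intros refl | simp)+
    moreover have "norm (g x) \<le> K * x ^ k" if "0 < x" "x < y" for x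
      using g[of x] that y by auto
    ultimately have "norm (G y - G 0) \<le> K * y ^ Suc k / real (Suc k) - K * 0 ^ Suc k / real (Suc k)"
      by (intro differentiable_bound_general[OF y(1) cont _ G(2)] continuous_intros) auto
    then show ?thesis
      using G(1) by simp
  qed
  consider "x = 0" | "x > 0" | "x < 0" by linarith
  then show ?thesis
  proof cases
    case 1
    then show ?thesis using \<open>F 0 = 0\<close> by simp
  next
    case 2
    then show ?thesis using pos[of F f x] F f assms(1,4) by simp
  next
    case 3
    have "((\<lambda>x. F (- x)) has_vector_derivative - f (- x)) (at x)" for x
      using vector_diff_chain_at[OF has_vector_derivative_minus[OF has_vector_derivative_id] F, of x]
      by (simp add: o_def)
    moreover have "norm (- f (- y)) \<le> K * \<bar>y\<bar> ^ k" if "\<bar>y\<bar> < T" for y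
      using f[of "- y"] that by simp
    ultimately show ?thesis using pos[of "\<lambda>x. F (- x)" "\<lambda>x. - f (- x)" "- x"] assms(1,4) 3 by simp
  qed
qed

text \<open>The solution is the Dyson series \<open>X = \<Sum>\<^sub>k U\<^sub>k\<close>, where \<open>U\<^sub>0 = x\<^sub>0\<close> and \<open>U\<^sub>k\<^sub>+\<^sub>1\<close> is the primitive of \<open>A U\<^sub>k\<close>
  vanishing at \<open>0\<close>. If \<open>\<parallel>A\<parallel> \<le> L\<close> on \<open>[-T, T]\<close>, then \<open>\<parallel>U\<^sub>k s\<parallel> \<le> \<parallel>x\<^sub>0\<parallel> (L \<bar>s\<bar>)\<^sup>k / k!\<close> there, so the series and
  the series of derivatives converge uniformly on every bounded interval. This works on
  the whole line at once, with no continuation of local solutions.\<close>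

lemma linear_ode_exists:
  fixes A :: "real \<Rightarrow> 'a::euclidean_space \<Rightarrow>\<^sub>L 'a"
  assumes A: "continuous_on UNIV A"
  shows "\<exists>X. X 0 = x0 \<and> (\<forall>s. (X has_vector_derivative A s (X s)) (at s))"
proof -
  define J where "J f = (SOME F. F 0 = 0 \<and> (\<forall>x. (F has_vector_derivative f x) (at x)))"
    for f :: "real \<Rightarrow> 'a"
  have J: "J f 0 = 0" "(J f has_vector_derivative f x) (at x)" if "continuous_on UNIV f" for f x
    using someI_ex[OF ex_primitive_at_0[OF that]] unfolding J_def by auto
  define U where "U = rec_nat (\<lambda>_. x0) (\<lambda>_ X. J (\<lambda>s. A s (X s)))"
  have U0: "U 0 = (\<lambda>_. x0)" and USuc: "U (Suc k) = J (\<lambda>s. A s (U k s))" for k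
    by (simp_all add: U_def)
  have contA: "continuous_on UNIV (\<lambda>s. A s (X s))" if "continuous_on UNIV X" for X
    using A that by (intro continuous_intros)
  have contU: "continuous_on UNIV (U k)" for k
  proof (induction k)
    case 0
    then show ?case by (simp add: U0)
  next
    case (Suc k)
    show ?case unfolding USuc
      using J(2)[OF contA[OF Suc]]
      by (meson continuous_at_imp_continuous_on has_vector_derivative_continuous)
  qed
  have U'Suc: "(U (Suc k) has_vector_derivative A s (U k s)) (at s)" and USuc0: "U (Suc k) 0 = 0" for k s
    unfolding USuc by (rule J[OF contA[OF contU]])+
  \<comment> \<open>The derivatives of the terms: the derivative series is the image of the series under \<open>A\<close>, shifted by one place.\<close>
  define U' where "U' k s = (case k of 0 \<Rightarrow> 0 | Suc j \<Rightarrow> A s (U j s))" for k s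
  have U': "(U k has_vector_derivative U' k s) (at s)" for k s
    by (cases k) (auto simp: U'_def U0 intro: U'Suc)
  have bounds: "\<exists>M M'. summable M \<and> summable M' \<and>
      (\<forall>k s. \<bar>s\<bar> < T \<longrightarrow> norm (U k s) \<le> M k \<and> norm (U' k s) \<le> M' k)" if "T > 0" for T
  proof -
    have "compact (A ` {-T..T})"
      by (intro compact_continuous_image continuous_on_subset[OF A]) auto
    then have "bounded (A ` {-T..T})"
      by (rule compact_imp_bounded)
    then obtain L where L: "L > 0" "\<And>s. s \<in> {-T..T} \<Longrightarrow> norm (A s) \<le> L"
      by (auto simp: bounded_pos)
    have AL: "norm (A s v) \<le> L * norm v" if "\<bar>s\<bar> < T" for s v
      using norm_blinfun[of "A s" v] mult_right_mono[OF L(2)[of s], of "norm v"] that by force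
    have U: "\<bar>s\<bar> < T \<Longrightarrow> norm (U k s) \<le> norm x0 * L ^ k / fact k * \<bar>s\<bar> ^ k" for k s
    proof (induction k arbitrary: s)
      case 0
      then show ?case by (simp add: U0)
    next
      case (Suc k)
      have "norm (U (Suc k) s) \<le> norm x0 * L ^ Suc k / fact k * \<bar>s\<bar> ^ Suc k / real (Suc k)"
      proof (rule norm_primitive_le_power[OF USuc0 U'Suc _ \<open>\<bar>s\<bar> < T\<close>])
        fix r :: real assume r: "\<bar>r\<bar> < T"
        have "norm (A r (U k r)) \<le> L * (norm x0 * L ^ k / fact k * \<bar>r\<bar> ^ k)"
          using order.trans[OF AL[OF r] mult_left_mono[OF Suc.IH[OF r]]] L(1) by simp
        then show "norm (A r (U k r)) \<le> norm x0 * L ^ Suc k / fact k * \<bar>r\<bar> ^ k"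
          by (simp add: mult_ac)
      qed
      then show ?case by (simp add: field_simps)
    qed
    define M where "M k = norm x0 * (inverse (fact k) * (L * T) ^ k)" for k
    define M' where "M' k = (case k of 0 \<Rightarrow> 0 | Suc j \<Rightarrow> L * M j)" for k
    have M: "summable M"
      unfolding M_def by (intro summable_mult summable_exp)
    have M': "summable M'"
      by (subst summable_Suc_iff[symmetric]) (simp add: M'_def summable_mult M)
    have UM: "norm (U k s) \<le> M k" if "\<bar>s\<bar> < T" for k s
    proof -
      have "norm x0 * L ^ k / fact k * \<bar>s\<bar> ^ k \<le> norm x0 * L ^ k / fact k * T ^ k"
        using that L by (intro mult_left_mono power_mono) auto
      with U[OF that, of k] show ?thesis
        by (simp add: M_def field_simps)
    qed
    have "norm (U' k s) \<le> M' k" if "\<bar>s\<bar> < T" for k s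
    proof (cases k)
      case (Suc j)
      then show ?thesis
        using order.trans[OF AL[OF that] mult_left_mono[OF UM[OF that]]] L(1)
        by (simp add: U'_def M'_def)
    qed (simp add: U'_def M'_def)
    with M M' UM show ?thesis by blast
  qed
  define X where "X s = (\<Sum>k. U k s)" for s
  have sumU: "summable (\<lambda>k. U k s)" for s
  proof -
    obtain M where "summable M" "\<And>k. norm (U k s) \<le> M k"
      using bounds[of "\<bar>s\<bar> + 1"] by fastforce
    then show ?thesis by (rule summable_comparison_test'[where N = 0])
  qed
  have X0: "X 0 = x0"
  proof -
    have "(\<lambda>k. U k 0) sums x0"
      using sums_finite[of "{0}" "\<lambda>k. U k 0"] USuc0 by (auto simp: U0 gr0_conv_Suc)
    then show ?thesis by (simp add: X_def sums_iff)
  qed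
  have "(X has_vector_derivative A s (X s)) (at s)" for s
  proof -
    define T where "T = \<bar>s\<bar> + 1"
    define S where "S = {-T<..<T}"
    have sS: "s \<in> S" by (auto simp: S_def T_def)
    have "T > 0" by (simp add: T_def)
    from bounds[OF this] obtain M' where M: "summable M'" "\<And>k s. \<bar>s\<bar> < T \<Longrightarrow> norm (U' k s) \<le> M' k"
      by auto
    have lim: "uniform_limit S (\<lambda>n x. \<Sum>i<n. U' i x) (\<lambda>x. suminf (\<lambda>i. U' i x)) sequentially"
      using M by (intro Weierstrass_m_test) (auto simp: S_def)
    have "\<exists>g. \<forall>x\<in>S. (\<lambda>n. U n x) sums g x \<and>
        (g has_derivative (\<lambda>h. h *\<^sub>R (\<Sum>i. U' i x))) (at x within S)"
    proof (rule has_derivative_series[OF _ _ _ sS summable_sums[OF sumU]])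
      show "(U n has_derivative (\<lambda>h. h *\<^sub>R U' n x)) (at x within S)" for n x
        using U'[of n x] unfolding has_vector_derivative_def by (rule has_derivative_at_withinI)
      show "\<forall>\<^sub>F n in sequentially. \<forall>x\<in>S. \<forall>h.
          norm ((\<Sum>i<n. h *\<^sub>R U' i x) - h *\<^sub>R (\<Sum>i. U' i x)) \<le> e * norm h" if "e > 0" for e
        using uniform_limitD[OF lim that]
      proof (rule eventually_mono, intro ballI allI)
        fix n x h
        assume "\<forall>x\<in>S. dist (\<Sum>i<n. U' i x) (\<Sum>i. U' i x) < e" "x \<in> S"
        then have "norm ((\<Sum>i<n. U' i x) - (\<Sum>i. U' i x)) \<le> e"
          by (auto simp: dist_norm less_imp_le)
        then have "\<bar>h\<bar> * norm ((\<Sum>i<n. U' i x) - (\<Sum>i. U' i x)) \<le> \<bar>h\<bar> * e"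
          by (rule mult_left_mono) auto
        then show "norm ((\<Sum>i<n. h *\<^sub>R U' i x) - h *\<^sub>R (\<Sum>i. U' i x)) \<le> e * norm h"
          by (simp add: scaleR_sum_right[symmetric] scaleR_right_diff_distrib[symmetric] mult.commute)
      qed
    qed (simp add: S_def)
    then obtain g where g: "\<And>x. x \<in> S \<Longrightarrow> (\<lambda>n. U n x) sums g x"
      "(g has_derivative (\<lambda>h. h *\<^sub>R (\<Sum>i. U' i s))) (at s within S)"
      using sS by blast
    have "(g has_vector_derivative (\<Sum>i. U' i s)) (at s)"
      using g(2) at_within_open[OF sS] by (simp add: has_vector_derivative_def S_def)
    then have "(X has_vector_derivative (\<Sum>i. U' i s)) (at s)"
    proof (rule has_vector_derivative_transform_within_open[OF _ _ sS])
      show "open S" by (simp add: S_def)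
      show "g x = X x" if "x \<in> S" for x
        using g(1)[OF that] by (simp add: X_def sums_iff)
    qed
    moreover have "(\<lambda>i. U' i s) sums A s (X s)"
    proof -
      have "(\<lambda>i. A s (U i s)) sums A s (X s)"
        unfolding X_def by (intro bounded_linear.sums[OF blinfun.bounded_linear_right] summable_sums sumU)
      then have "(\<lambda>i. U' (Suc i) s) sums A s (X s)"
        by (simp add: U'_def)
      then show ?thesis
        by (subst (asm) sums_Suc_iff) (simp add: U'_def)
    qed
    ultimately show ?thesis
      by (simp add: sums_iff)
  qed
  with X0 show ?thesis by blast
qed

section \<open>The Serret--Frenet system\<close>

lemma serret_frenetD:
  assumes "serret_frenet c \<tau> m n b"
  shows "(m has_vector_derivative c s *\<^sub>R n s) (at s)"
    "(n has_vector_derivative - c s *\<^sub>R m s + \<tau> s *\<^sub>R b s) (at s)"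
    "(b has_vector_derivative - \<tau> s *\<^sub>R n s) (at s)"
  using assms by (auto simp: serret_frenet_def)

lemma serret_frenet_exists:
  assumes "continuous_on UNIV c" "continuous_on UNIV \<tau>"
  shows "\<exists>m n b. serret_frenet c \<tau> m n b \<and> m 0 = m0 \<and> n 0 = n0 \<and> b 0 = b0"
proof -
  define P :: "((real^3) \<times> (real^3) \<times> (real^3)) \<Rightarrow>\<^sub>L ((real^3) \<times> (real^3) \<times> (real^3))"
    where "P = Blinfun (\<lambda>(m, n, b). (n, - m, 0))"
  define Q :: "((real^3) \<times> (real^3) \<times> (real^3)) \<Rightarrow>\<^sub>L ((real^3) \<times> (real^3) \<times> (real^3))"
    where "Q = Blinfun (\<lambda>(m, n, b). (0, b, - n))"
  have P: "P v = (fst (snd v), - fst v, 0)" for v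
    unfolding P_def case_prod_beta
    by (subst bounded_linear_Blinfun_apply) (auto intro!: bounded_linear_intros bounded_linear_minus)
  have Q: "Q v = (0, snd (snd v), - fst (snd v))" for v
    unfolding Q_def case_prod_beta
    by (subst bounded_linear_Blinfun_apply) (auto intro!: bounded_linear_intros bounded_linear_minus)
  have "continuous_on UNIV (\<lambda>s. c s *\<^sub>R P + \<tau> s *\<^sub>R Q)"
    using assms by (intro continuous_intros)
  from linear_ode_exists[OF this, of "(m0, n0, b0)"] obtain X where X: "X 0 = (m0, n0, b0)"
    "\<And>s. (X has_vector_derivative (c s *\<^sub>R P + \<tau> s *\<^sub>R Q) (X s)) (at s)"
    by blast
  have X': "(X has_vector_derivative (c s *\<^sub>R fst (snd (X s)),
      - c s *\<^sub>R fst (X s) + \<tau> s *\<^sub>R snd (snd (X s)), - \<tau> s *\<^sub>R fst (snd (X s)))) (at s)" for s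
    using X(2)[of s] by (simp add: blinfun.add_left blinfun.scaleR_left P Q)
  have "serret_frenet c \<tau> (\<lambda>s. fst (X s)) (\<lambda>s. fst (snd (X s))) (\<lambda>s. snd (snd (X s)))"
    unfolding serret_frenet_def
    using bounded_linear.has_vector_derivative[OF bounded_linear_fst X']
      bounded_linear.has_vector_derivative[OF bounded_linear_fst_comp[OF bounded_linear_snd] X']
      bounded_linear.has_vector_derivative[OF bounded_linear_snd_comp[OF bounded_linear_snd] X']
    by simp
  with X(1) show ?thesis
    by (intro exI[of _ "\<lambda>s. fst (X s)"] exI[of _ "\<lambda>s. fst (snd (X s))"] exI[of _ "\<lambda>s. snd (snd (X s))"]) simp
qed

lemma inner_self_has_derivative:
  fixes f :: "real \<Rightarrow> 'a::real_inner"
  assumes "(f has_vector_derivative f') (at s)"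
  shows "((\<lambda>s. f s \<bullet> f s) has_vector_derivative 2 * (f s \<bullet> f')) (at s)"
  using bounded_bilinear.has_vector_derivative[OF bounded_bilinear_inner assms assms]
  by (simp add: inner_commute)

lemma has_vector_derivative_0_imp_const:
  assumes "\<And>s. (f has_vector_derivative 0) (at s)"
  shows "f x = f (y::real)"
  using has_vector_derivative_zero_constant[of UNIV f] assms by (metis UNIV_I convex_UNIV)

text \<open>The matrix of the system is skew-symmetric.\<close>

lemma serret_frenet_energy:
  assumes "serret_frenet c \<tau> m n b"
  shows "m s \<bullet> m s + n s \<bullet> n s + b s \<bullet> b s = m 0 \<bullet> m 0 + n 0 \<bullet> n 0 + b 0 \<bullet> b 0"
proof (rule has_vector_derivative_0_imp_const[where f = "\<lambda>s. m s \<bullet> m s + n s \<bullet> n s + b s \<bullet> b s"])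
  fix s
  note D = serret_frenetD[OF assms, of s]
  show "((\<lambda>s. m s \<bullet> m s + n s \<bullet> n s + b s \<bullet> b s) has_vector_derivative 0) (at s)"
    using has_vector_derivative_add[OF has_vector_derivative_add[OF
      D(1)[THEN inner_self_has_derivative] D(2)[THEN inner_self_has_derivative]]
      D(3)[THEN inner_self_has_derivative]]
    by (simp add: inner_diff_right inner_commute algebra_simps)
qed

lemma serret_frenet_diff:
  assumes "serret_frenet c \<tau> m n b" "serret_frenet c \<tau> m' n' b'"
  shows "serret_frenet c \<tau> (\<lambda>s. m s - m' s) (\<lambda>s. n s - n' s) (\<lambda>s. b s - b' s)"
  unfolding serret_frenet_def
  using serret_frenetD[OF assms(1), THEN has_vector_derivative_diff] serret_frenetD[OF assms(2)]
  by (fastforce simp: algebra_simps)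

lemma serret_frenet_unique:
  assumes "serret_frenet c \<tau> m n b" "serret_frenet c \<tau> m' n' b'"
    and "m 0 = m' 0" "n 0 = n' 0" "b 0 = b' 0"
  shows "m = m' \<and> n = n' \<and> b = b'"
proof -
  have "(m s - m' s) \<bullet> (m s - m' s) + (n s - n' s) \<bullet> (n s - n' s) + (b s - b' s) \<bullet> (b s - b' s) = 0" for s
    using serret_frenet_energy[OF serret_frenet_diff[OF assms(1,2)], of s] assms(3-5) by simp
  then have "m s = m' s \<and> n s = n' s \<and> b s = b' s" for s
    by (smt (verit) inner_ge_zero inner_eq_zero_iff eq_iff_diff_eq_0)
  then show ?thesis by blast
qed

lemma has_vector_derivative_cross3:
  assumes "(f has_vector_derivative f') (at s)" "(g has_vector_derivative g') (at s)"
  shows "((\<lambda>s. cross3 (f s) (g s)) has_vector_derivative cross3 (f s) g' + cross3 f' (g s)) (at s)"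
  by (rule bounded_bilinear.has_vector_derivative[OF _ assms])
    (use bilinear_cross bilinear_conv_bounded_bilinear in blast)

text \<open>The system recombines the three vectors by infinitesimal rotations. A rotation matrix equals
  its own cofactor matrix, so the pairwise cross products are recombined in the same way.\<close>

lemma serret_frenet_cross:
  assumes "serret_frenet c \<tau> m n b"
  shows "serret_frenet c \<tau> (\<lambda>s. cross3 (n s) (b s)) (\<lambda>s. cross3 (b s) (m s)) (\<lambda>s. cross3 (m s) (n s))"
  unfolding serret_frenet_def
proof (intro allI conjI)
  fix s
  note D = serret_frenetD[OF assms, of s]
  note simps = Cross3.left_diff_distrib Cross3.right_diff_distrib cross_add_left cross_add_right cross_mult_left cross_mult_right
  show "((\<lambda>s. cross3 (n s) (b s)) has_vector_derivative c s *\<^sub>R cross3 (b s) (m s)) (at s)"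
    using has_vector_derivative_cross3[OF D(2,3)] cross_skew[of "m s" "b s"] by (simp add: simps)
  show "((\<lambda>s. cross3 (b s) (m s)) has_vector_derivative
      - c s *\<^sub>R cross3 (n s) (b s) + \<tau> s *\<^sub>R cross3 (m s) (n s)) (at s)"
    using has_vector_derivative_cross3[OF D(3,1)] cross_skew[of "b s" "n s"] cross_skew[of "n s" "m s"]
    by (simp add: simps)
  show "((\<lambda>s. cross3 (m s) (n s)) has_vector_derivative - \<tau> s *\<^sub>R cross3 (b s) (m s)) (at s)"
    using has_vector_derivative_cross3[OF D(1,2)] cross_skew[of "b s" "m s"] by (simp add: simps)
qed

text \<open>The standard basis is its own dual triple, so by uniqueness the frame coincides with its dual
  triple everywhere. This already makes its members pairwise orthogonal, and hence their
  lengths constant.\<close>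

lemma serret_frenet_orthonormal:
  assumes sf: "serret_frenet c \<tau> m n b"
    and init: "m 0 = vector [1, 0, 0]" "n 0 = vector [0, 1, 0]" "b 0 = vector [0, 0, 1]"
  shows "cross3 (n s) (b s) = m s" "cross3 (b s) (m s) = n s" "cross3 (m s) (n s) = b s"
    and "norm (m s) = 1" "norm (n s) = 1" "norm (b s) = 1"
proof -
  have cr: "cross3 (n s) (b s) = m s" "cross3 (b s) (m s) = n s" "cross3 (m s) (n s) = b s" for s
    using serret_frenet_unique[OF serret_frenet_cross[OF sf] sf]
    by (simp_all add: init fun_eq_iff) (auto simp: cross3_def vec_eq_iff forall_3 init)
  then show "cross3 (n s) (b s) = m s" "cross3 (b s) (m s) = n s" "cross3 (m s) (n s) = b s"
    by blast+
  have orth: "m s \<bullet> n s = 0" "n s \<bullet> b s = 0" "n s \<bullet> m s = 0" "b s \<bullet> n s = 0" for s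
    using cr(2)[of s] dot_cross_self by (metis inner_commute)+
  note D = serret_frenetD[OF sf]
  have "m s \<bullet> m s = m 0 \<bullet> m 0"
    by (rule has_vector_derivative_0_imp_const[where f = "\<lambda>s. m s \<bullet> m s"])
      (use inner_self_has_derivative[OF D(1)] orth in simp)
  then show "norm (m s) = 1"
    by (simp add: norm_eq_1 init inner_vec_def sum_3)
  have "n s \<bullet> n s = n 0 \<bullet> n 0"
    by (rule has_vector_derivative_0_imp_const[where f = "\<lambda>s. n s \<bullet> n s"])
      (use inner_self_has_derivative[OF D(2)] orth in \<open>simp add: inner_diff_right\<close>)
  then show "norm (n s) = 1"
    by (simp add: norm_eq_1 init inner_vec_def sum_3)
  have "b s \<bullet> b s = b 0 \<bullet> b 0"
    by (rule has_vector_derivative_0_imp_const[where f = "\<lambda>s. b s \<bullet> b s"])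
      (use inner_self_has_derivative[OF D(3)] orth in simp)
  then show "norm (b s) = 1"
    by (simp add: norm_eq_1 init inner_vec_def sum_3)
qed

section \<open>Smoothness\<close>

text \<open>Smoothness is split into finite orders because the arguments below bootstrap: they pass from
  order \<open>k\<close> for the right-hand side of a differential equation to order \<open>k + 1\<close> for its solution.\<close>

definition times_differentiable :: "nat \<Rightarrow> (real \<Rightarrow> 'a::real_normed_vector) \<Rightarrow> bool"
  where "times_differentiable k f \<longleftrightarrow> (\<forall>j<k. \<forall>x. (vderiv ^^ j) f differentiable (at x))"

lemma smooth_iff_times_differentiable: "smooth f \<longleftrightarrow> (\<forall>k. times_differentiable k f)"
  by (auto simp: smooth_def times_differentiable_def)

lemma times_differentiable_0 [simp]: "times_differentiable 0 f"
  by (simp add: times_differentiable_def)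

lemma vderiv_eqI:
  assumes "\<And>x. (f has_vector_derivative f' x) (at x)"
  shows "vderiv f = f'"
  using assms by (auto simp: vderiv_def fun_eq_iff intro: vector_derivative_at)

lemma times_differentiable_Suc:
  assumes "\<And>x. (f has_vector_derivative f' x) (at x)"
  shows "times_differentiable (Suc k) f \<longleftrightarrow> times_differentiable k f'"
proof -
  have "(\<forall>j<Suc k. \<forall>x. (vderiv ^^ j) f differentiable (at x)) \<longleftrightarrow>
      (\<forall>x. f differentiable (at x)) \<and> (\<forall>j<k. \<forall>x. (vderiv ^^ Suc j) f differentiable (at x))"
    by (auto simp: less_Suc_eq_0_disj)
  moreover have "(vderiv ^^ Suc j) f = (vderiv ^^ j) f'" for j
    by (simp only: funpow_Suc_right o_apply vderiv_eqI[OF assms])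
  ultimately show ?thesis
    using assms differentiableI_vector unfolding times_differentiable_def by metis
qed

lemma times_differentiable_has_derivative:
  assumes "times_differentiable (Suc k) f"
  shows "(f has_vector_derivative vderiv f x) (at x)"
  using assms[unfolded times_differentiable_def, rule_format, of 0 x]
  by (simp add: vderiv_def vector_derivative_works)

lemma times_differentiable_mono:
  "times_differentiable k f \<Longrightarrow> j \<le> k \<Longrightarrow> times_differentiable j f"
  by (auto simp: times_differentiable_def)

lemma times_differentiable_const: "times_differentiable k (\<lambda>x. c)"
proof (induction k arbitrary: c)
  case (Suc k)
  then show ?case
    by (subst times_differentiable_Suc[where f' = "\<lambda>_. 0"]) auto
qed simp

lemma times_differentiable_add:
  "times_differentiable k f \<Longrightarrow> times_differentiable k g \<Longrightarrow> times_differentiable k (\<lambda>x. f x + g x)"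
proof (induction k arbitrary: f g)
  case (Suc k)
  note D = Suc.prems[THEN times_differentiable_has_derivative]
  show ?case
    using Suc.prems
    by (simp add: times_differentiable_Suc[OF D(1)] times_differentiable_Suc[OF D(2)] Suc.IH
        times_differentiable_Suc[OF has_vector_derivative_add[OF D]])
qed simp

lemma times_differentiable_scaleR:
  "times_differentiable k f \<Longrightarrow> times_differentiable k g \<Longrightarrow> times_differentiable k (\<lambda>x. f x *\<^sub>R g x)"
proof (induction k arbitrary: f g)
  case (Suc k)
  note D = Suc.prems[THEN times_differentiable_has_derivative]
  have P: "((\<lambda>x. f x *\<^sub>R g x) has_vector_derivative f x *\<^sub>R vderiv g x + vderiv f x *\<^sub>R g x) (at x)" for x
    using D by (intro derivative_intros) (simp add: has_real_derivative_iff_has_vector_derivative)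
  have "times_differentiable k (vderiv f)" "times_differentiable k (vderiv g)"
    "times_differentiable k f" "times_differentiable k g"
    using Suc.prems times_differentiable_Suc[OF D(1)] times_differentiable_Suc[OF D(2)]
      Suc.prems[THEN times_differentiable_mono, of k] by auto
  then show ?case
    by (simp add: times_differentiable_Suc[OF P] Suc.IH times_differentiable_add)
qed simp

lemma times_differentiable_cmult:
  fixes f :: "real \<Rightarrow> real"
  shows "times_differentiable k f \<Longrightarrow> times_differentiable k (\<lambda>x. a * f x)"
  using times_differentiable_scaleR[OF times_differentiable_const[of k a], of f] by simp

lemma times_differentiable_ident: "times_differentiable k (\<lambda>x. x)"
  by (cases k) (auto simp: times_differentiable_Suc[OF has_vector_derivative_id] times_differentiable_const)

lemma gaussian_has_derivative:
  "((\<lambda>s. c0 * exp (- \<alpha> * s\<^sup>2 / 4)) has_vector_derivative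
    (- \<alpha> / 2 * s) * (c0 * exp (- \<alpha> * s\<^sup>2 / 4))) (at s)"
  unfolding has_real_derivative_iff_has_vector_derivative[symmetric]
  by (rule derivative_eq_intros refl | simp)+

lemma times_differentiable_gaussian: "times_differentiable k (\<lambda>s. c0 * exp (- \<alpha> * s\<^sup>2 / 4))"
proof (induction k)
  case (Suc k)
  then have "times_differentiable k (\<lambda>s. (- \<alpha> / 2 * s) *\<^sub>R (c0 * exp (- \<alpha> * s\<^sup>2 / 4)))"
    by (rule times_differentiable_scaleR[OF times_differentiable_cmult[OF times_differentiable_ident]])
  then show ?case
    by (subst times_differentiable_Suc[OF gaussian_has_derivative]) (simp only: real_scaleR_def)
qed simp

text \<open>Bootstrapping has to treat the three vectors simultaneously, since the derivative of each
  involves the others.\<close>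

lemma serret_frenet_times_differentiable:
  assumes sf: "serret_frenet c \<tau> m n b"
    and c: "\<And>k. times_differentiable k c" and \<tau>: "\<And>k. times_differentiable k \<tau>"
  shows "times_differentiable k m \<and> times_differentiable k n \<and> times_differentiable k b"
proof (induction k)
  case (Suc k)
  have neg: "times_differentiable k (\<lambda>s. - c s)" "times_differentiable k (\<lambda>s. - \<tau> s)"
    using times_differentiable_cmult[of k _ "-1"] c \<tau> by fastforce+
  have "times_differentiable k (\<lambda>s. c s *\<^sub>R n s)"
    "times_differentiable k (\<lambda>s. - c s *\<^sub>R m s + \<tau> s *\<^sub>R b s)"
    "times_differentiable k (\<lambda>s. - \<tau> s *\<^sub>R n s)"
    using Suc c \<tau> neg by (simp_all only: times_differentiable_scaleR times_differentiable_add)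
  then show ?case
    by (simp only: simp_thms times_differentiable_Suc[OF serret_frenetD(1)[OF sf]]
        times_differentiable_Suc[OF serret_frenetD(2)[OF sf]]
        times_differentiable_Suc[OF serret_frenetD(3)[OF sf]])
qed simp

lemma has_vector_derivative_rescale:
  assumes "(f has_vector_derivative f') (at (x / a))"
  shows "((\<lambda>x. f (x / a)) has_vector_derivative (1 / a) *\<^sub>R f') (at x)"
proof -
  have "((\<lambda>x. x / a) has_vector_derivative 1 / a) (at x)"
    unfolding has_real_derivative_iff_has_vector_derivative[symmetric]
    using DERIV_cdivide[OF DERIV_ident, of a x UNIV] .
  from vector_diff_chain_at[OF this assms] show ?thesis by (simp add: o_def)
qed

lemma smooth_has_derivative:
  assumes "smooth f"
  shows "((vderiv ^^ k) f has_vector_derivative (vderiv ^^ Suc k) f x) (at x)"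
  using assms by (simp add: smooth_def vderiv_def vector_derivative_works[symmetric])

lemma funpow_vderiv_rescale:
  assumes "smooth f"
  shows "(vderiv ^^ k) (\<lambda>x. f (x / a)) = (\<lambda>x. (1 / a) ^ k *\<^sub>R (vderiv ^^ k) f (x / a))"
proof (induction k)
  case (Suc k)
  have "((\<lambda>x. (1 / a) ^ k *\<^sub>R (vderiv ^^ k) f (x / a)) has_vector_derivative
      (1 / a) ^ Suc k *\<^sub>R (vderiv ^^ Suc k) f (x / a)) (at x)" for x
    using bounded_linear.has_vector_derivative[OF bounded_linear_scaleR_right
      has_vector_derivative_rescale[OF smooth_has_derivative[OF assms]], of "(1 / a) ^ k" k a x]
    by (simp add: mult.commute)
  from vderiv_eqI[OF this] show ?case
    by (simp add: Suc)
qed simp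

lemma smooth_rescale:
  assumes "smooth f"
  shows "smooth (\<lambda>x. f (x / a))"
  unfolding smooth_def funpow_vderiv_rescale[OF assms]
proof (intro allI)
  fix k x
  show "(\<lambda>x. (1 / a) ^ k *\<^sub>R (vderiv ^^ k) f (x / a)) differentiable at x"
    using has_vector_derivative_rescale[OF smooth_has_derivative[OF assms], THEN differentiableI_vector]
    by (intro differentiable_scaleR differentiable_const)
qed

lemma smooth_continuous_on:
  assumes "smooth f"
  shows "continuous_on S ((vderiv ^^ k) f)"
  using smooth_has_derivative[OF assms]
  by (meson continuous_at_imp_continuous_on has_vector_derivative_continuous)

section \<open>Self-similar solutions of the Landau--Lifshitz--Gilbert equation\<close>

text \<open>The frame is a parameter, tied to \<open>profile\<close> by uniqueness only in \<open>profile_eq\<close>, so that its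
  differential equations are available without any reference to the definite description.\<close>

locale LLG_profile =
  fixes c0 \<alpha> \<beta> :: real and c \<tau> :: "real \<Rightarrow> real" and m n b :: "real \<Rightarrow> real^3"
  assumes \<alpha>: "0 \<le> \<alpha>" "\<alpha> \<le> 1" and \<beta>: "\<beta> = sqrt (1 - \<alpha>\<^sup>2)" and c0: "c0 > 0"
    and c_def: "c = (\<lambda>s. c0 * exp (- \<alpha> * s\<^sup>2 / 4))"
    and \<tau>_def: "\<tau> = (\<lambda>s. \<beta> * s / 2)"
    and frame: "serret_frenet c \<tau> m n b"
    and init: "m 0 = vector [1, 0, 0]" "n 0 = vector [0, 1, 0]" "b 0 = vector [0, 0, 1]"
begin

lemma profile_eq: "profile c0 \<alpha> = m"
proof -
  have "profile_frame c0 \<alpha> = (m, n, b)"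
    unfolding profile_frame_def c_def[symmetric] \<beta>[symmetric] \<tau>_def[symmetric]
  proof (rule the_equality)
    show "case (m, n, b) of (m, n, b) \<Rightarrow> serret_frenet c \<tau> m n b \<and>
        m 0 = vector [1, 0, 0] \<and> n 0 = vector [0, 1, 0] \<and> b 0 = vector [0, 0, 1]"
      by (simp add: frame init)
  qed (use serret_frenet_unique[OF _ frame] init in auto)
  then show ?thesis by (simp add: profile_def)
qed

lemmas self_similar_eq = self_similar_def[of c0 \<alpha>, unfolded profile_eq]

lemmas D = serret_frenetD[OF frame]
lemmas orthonormal = serret_frenet_orthonormal[OF frame init]

lemma c'_eq: "(c has_vector_derivative - \<alpha> / 2 * s * c s) (at s)"
  using gaussian_has_derivative[of c0 \<alpha> s] by (simp add: c_def)

lemma \<alpha>\<beta>: "\<alpha>\<^sup>2 + \<beta>\<^sup>2 = 1"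
  using \<alpha> by (simp add: \<beta> power_le_one)

lemma smooth_m: "smooth m"
proof -
  have "times_differentiable k \<tau>" for k
    using times_differentiable_cmult[OF times_differentiable_ident, of k "\<beta> / 2"] by (simp add: \<tau>_def)
  then show ?thesis
    using serret_frenet_times_differentiable[OF frame] times_differentiable_gaussian
    by (simp add: smooth_iff_times_differentiable c_def)
qed

lemma vderiv_m: "vderiv m = (\<lambda>s. c s *\<^sub>R n s)"
  using D(1) by (rule vderiv_eqI)

lemma vderiv2_m:
  "(vderiv ^^ 2) m = (\<lambda>s. (- \<alpha> / 2 * s * c s) *\<^sub>R n s - (c s)\<^sup>2 *\<^sub>R m s + (\<beta> / 2 * s * c s) *\<^sub>R b s)"
proof -
  have "((\<lambda>s. c s *\<^sub>R n s) has_vector_derivative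
      c s *\<^sub>R (- c s *\<^sub>R m s + \<tau> s *\<^sub>R b s) + (- \<alpha> / 2 * s * c s) *\<^sub>R n s) (at s)" for s
    using c'_eq D(2)
    by (intro derivative_intros) (simp_all add: has_real_derivative_iff_has_vector_derivative)
  from vderiv_eqI[OF this] show ?thesis
    by (simp add: numeral_2_eq_2 vderiv_m fun_eq_iff \<tau>_def power2_eq_square algebra_simps)
qed

text \<open>With \<open>c' = - \<alpha> s c / 2\<close> and \<open>\<tau> = \<beta> s / 2\<close>, the coefficients of \<open>b\<close> in the two terms cancel, and
  those of \<open>n\<close> combine through \<open>\<alpha>\<^sup>2 + \<beta>\<^sup>2 = 1\<close>. The right-hand side is the time derivative of
  \<open>m (s / \<surd>t)\<close> at \<open>t = 1\<close>: this is the equation satisfied by self-similar profiles.\<close>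

lemma profile_ode:
  defines "m2 \<equiv> (vderiv ^^ 2) m"
  shows "\<beta> *\<^sub>R cross3 (m s) (m2 s) - \<alpha> *\<^sub>R cross3 (m s) (cross3 (m s) (m2 s)) = - (s / 2) *\<^sub>R (c s *\<^sub>R n s)"
proof -
  have mb: "cross3 (m s) (b s) = - n s"
    using cross_skew[of "m s" "b s"] orthonormal(2) by simp
  note simps = Cross3.left_diff_distrib Cross3.right_diff_distrib cross_add_left cross_add_right
    cross_mult_left cross_mult_right
  have 1: "cross3 (m s) (m2 s) = (- \<alpha> / 2 * s * c s) *\<^sub>R b s - (\<beta> / 2 * s * c s) *\<^sub>R n s"
    by (simp add: m2_def vderiv2_m simps orthonormal(3) mb)
  have 2: "cross3 (m s) (cross3 (m s) (m2 s)) =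
      (\<alpha> / 2 * s * c s) *\<^sub>R n s - (\<beta> / 2 * s * c s) *\<^sub>R b s"
    unfolding 1 by (simp add: simps orthonormal(3) mb)
  have "\<beta> *\<^sub>R cross3 (m s) (m2 s) - \<alpha> *\<^sub>R cross3 (m s) (cross3 (m s) (m2 s)) =
      - ((\<alpha>\<^sup>2 + \<beta>\<^sup>2) * (s / 2 * c s)) *\<^sub>R n s"
    unfolding 2 unfolding 1 by (simp add: algebra_simps add_divide_distrib power2_eq_square)
  then show ?thesis
    by (simp add: \<alpha>\<beta>)
qed

lemma time_derivative:
  assumes "t > 0"
  shows "((\<lambda>t. m (s / sqrt t)) has_vector_derivative
    (- (s / sqrt t) / (2 * t)) *\<^sub>R (c (s / sqrt t) *\<^sub>R n (s / sqrt t))) (at t)"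
proof -
  have "((\<lambda>t. s / sqrt t) has_vector_derivative (- (s / sqrt t) / (2 * t))) (at t)"
    unfolding has_real_derivative_iff_has_vector_derivative[symmetric] using assms
    by (auto intro!: derivative_eq_intros simp: field_simps)
  from vector_diff_chain_at[OF this D(1)] show ?thesis
    by (simp add: o_def)
qed

lemma regular_solution: "regular_LLG_solution \<alpha> \<beta> (self_similar c0 \<alpha>)"
proof -
  let ?S = "{(s, t :: real). t > 0} :: (real \<times> real) set"
  have cont: "continuous_on ?S (\<lambda>(s, t). s / sqrt t)"
    by (auto simp: case_prod_beta intro!: continuous_intros)
  have cn: "continuous_on UNIV (\<lambda>s. c s *\<^sub>R n s)"
    using smooth_continuous_on[OF smooth_m, of UNIV 1] by (simp add: vderiv_m)
  have vt: "vderiv (\<lambda>\<theta>. m (s / sqrt \<theta>)) t =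
      (- (s / sqrt t) / (2 * t)) *\<^sub>R (c (s / sqrt t) *\<^sub>R n (s / sqrt t))" if "t > 0" for s t
    unfolding vderiv_def using time_derivative[OF that] by (rule vector_derivative_at)
  have "continuous_on ?S (\<lambda>(s, t). (vderiv ^^ k) (\<lambda>\<sigma>. m (\<sigma> / sqrt t)) s)" for k
    unfolding funpow_vderiv_rescale[OF smooth_m]
    using continuous_on_compose2[OF smooth_continuous_on[OF smooth_m] cont, of UNIV k]
    by (auto simp: case_prod_beta intro!: continuous_intros)
  moreover have "continuous_on ?S (\<lambda>(s, t). vderiv (\<lambda>\<theta>. m (s / sqrt \<theta>)) t)"
  proof -
    have "continuous_on ?S (\<lambda>p. c (fst p / sqrt (snd p)) *\<^sub>R n (fst p / sqrt (snd p)))"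
      using continuous_on_compose2[OF cn cont] by (simp add: case_prod_beta)
    then have "continuous_on ?S (\<lambda>p. (- (fst p / sqrt (snd p)) / (2 * snd p)) *\<^sub>R
        (c (fst p / sqrt (snd p)) *\<^sub>R n (fst p / sqrt (snd p))))"
      by (rule continuous_on_scaleR[rotated]) (auto intro!: continuous_intros)
    then show ?thesis
      by (rule continuous_on_eq) (auto simp: vt)
  qed
  moreover have "let mm = m (s / sqrt t); mss = (vderiv ^^ 2) (\<lambda>\<sigma>. m (\<sigma> / sqrt t)) s in
       vderiv (\<lambda>\<theta>. m (s / sqrt \<theta>)) t = \<beta> *\<^sub>R cross3 mm mss - \<alpha> *\<^sub>R cross3 mm (cross3 mm mss)"
    if "t > 0" for s t
  proof -
    define \<sigma> where "\<sigma> = s / sqrt t"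
    have "(1 / sqrt t)\<^sup>2 = 1 / t"
      using that by (simp add: power_divide)
    then have "(vderiv ^^ 2) (\<lambda>\<sigma>. m (\<sigma> / sqrt t)) s = (1 / t) *\<^sub>R (vderiv ^^ 2) m \<sigma>"
      by (simp add: funpow_vderiv_rescale[OF smooth_m] \<sigma>_def)
    moreover have "vderiv (\<lambda>\<theta>. m (s / sqrt \<theta>)) t = (1 / t) *\<^sub>R (- (\<sigma> / 2) *\<^sub>R (c \<sigma> *\<^sub>R n \<sigma>))"
      by (simp add: vt[OF that] \<sigma>_def)
    ultimately show ?thesis
      unfolding Let_def profile_ode[symmetric] \<sigma>_def[symmetric]
      by (simp add: cross_mult_right scaleR_right_diff_distrib mult.commute)
  qed
  ultimately show ?thesis
    unfolding regular_LLG_solution_def self_similar_eq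
    using smooth_rescale[OF smooth_m] orthonormal(4) differentiableI_vector[OF time_derivative]
    by simp
qed

end

section \<open>Convergence at infinity with a rate\<close>

text \<open>Comparison of \<open>f\<close> with the nondecreasing function \<open>\<phi> x = - K / (r x\<^sup>r)\<close>, which tends to \<open>0\<close>:
  increments of \<open>f\<close> are dominated by those of \<open>\<phi>\<close>.\<close>

lemma converges_with_power_rate:
  fixes f :: "real \<Rightarrow> 'a::banach"
  assumes f: "\<And>x. x > 0 \<Longrightarrow> (f has_vector_derivative f' x) (at x)"
    and f': "\<And>x. x > 0 \<Longrightarrow> norm (f' x) \<le> K / x ^ Suc r" and "r > 0"
  shows "\<exists>A. \<forall>x>(0::real). norm (f x - A) \<le> K / (r * x ^ r)"
proof -
  define \<phi> where "\<phi> x = - (K / (r * x ^ r))" for x :: real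
  have "K \<ge> 0"
    using order.trans[OF norm_ge_zero f'[of 1]] by simp
  have \<phi>: "(\<phi> has_vector_derivative K / x ^ Suc r) (at x)" if "x > 0" for x
  proof -
    obtain j where j: "r = Suc j"
      using \<open>r > 0\<close> gr0_conv_Suc by blast
    have "\<phi> = (\<lambda>x. - (K / r) * inverse x ^ r)"
      by (auto simp: \<phi>_def fun_eq_iff divide_inverse power_inverse)
    moreover have "((\<lambda>x. inverse x ^ r) has_real_derivative r * inverse x ^ j * - (inverse x ^ 2)) (at x)"
      using DERIV_power[OF DERIV_inverse[of x UNIV], of r] that by (simp add: j numeral_2_eq_2 mult_ac)
    from DERIV_cmult[OF this, of "- (K / r)"]
    have "((\<lambda>x. - (K / r) * inverse x ^ r) has_real_derivative K / x ^ Suc r) (at x)"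
      by (simp add: j divide_inverse power_inverse power2_eq_square mult_ac)
    ultimately show ?thesis
      by (simp add: has_real_derivative_iff_has_vector_derivative)
  qed
  have inc: "norm (f y - f x) \<le> \<phi> y - \<phi> x" if "0 < x" "x \<le> y" for x y
  proof (cases "x = y")
    case False
    have pos: "z > 0" if "z \<in> {x..y}" for z
      using that \<open>0 < x\<close> by simp
    show ?thesis
    proof (rule differentiable_bound_general[where f' = f' and \<phi>' = "\<lambda>x. K / x ^ Suc r"])
      show "continuous_on {x..y} f" "continuous_on {x..y} \<phi>"
        using has_vector_derivative_continuous[OF f] has_vector_derivative_continuous[OF \<phi>] pos
        by (auto intro!: continuous_at_imp_continuous_on)
    qed (use False that in \<open>auto intro: f f' \<phi> simp del: power_Suc\<close>)
  qed simp
  have \<phi>0: "\<phi> x \<le> 0" if "x > 0" for x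
    using \<open>K \<ge> 0\<close> that by (simp add: \<phi>_def)
  have bound: "norm (f y - f x) \<le> K / (r * x ^ r)" if "0 < x" "x \<le> y" for x y :: real
    using inc[OF that] \<phi>0[of y] that by (simp add: \<phi>_def)
  have lim: "((\<lambda>x::real. K / (r * x ^ r)) \<longlongrightarrow> 0) at_top"
    using \<open>r > 0\<close>
    by (intro real_tendsto_divide_at_top tendsto_const filterlim_tendsto_pos_mult_at_top[OF tendsto_const]
        filterlim_pow_at_top filterlim_ident) auto
  have "Cauchy (\<lambda>k. f (real (Suc k)))"
  proof (rule CauchyI)
    fix e :: real assume "e > 0"
    then have "\<forall>\<^sub>F x::real in at_top. K / (r * x ^ r) < e"
      by (rule order_tendstoD(2)[OF lim])
    then obtain N where N: "\<And>x::real. x \<ge> N \<Longrightarrow> K / (r * x ^ r) < e"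
      by (auto simp: eventually_at_top_linorder)
    show "\<exists>M. \<forall>i\<ge>M. \<forall>j\<ge>M. norm (f (real (Suc i)) - f (real (Suc j))) < e"
    proof (intro exI allI impI)
      fix i j assume ij: "nat \<lceil>N\<rceil> \<le> i" "nat \<lceil>N\<rceil> \<le> j"
      have N: "K / (r * real (Suc k) ^ r) < e" if "nat \<lceil>N\<rceil> \<le> k" for k
      proof (rule N)
        show "N \<le> real (Suc k)" using that by linarith
      qed
      show "norm (f (real (Suc i)) - f (real (Suc j))) < e"
        using bound[of "real (Suc j)" "real (Suc i)"] bound[of "real (Suc i)" "real (Suc j)"]
          N[OF ij(1)] N[OF ij(2)] norm_minus_commute[of "f (real (Suc i))"]
        by (cases "i \<le> j") auto
    qed
  qed
  then obtain A where A: "(\<lambda>k. f (real (Suc k))) \<longlonglongrightarrow> A"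
    using Cauchy_convergent_iff convergent_def by blast
  have "norm (f x - A) \<le> K / (r * x ^ r)" if "x > 0" for x :: real
  proof (rule tendsto_upperbound)
    show "(\<lambda>k. norm (f x - f (real (Suc k)))) \<longlonglongrightarrow> norm (f x - A)"
      by (intro tendsto_intros A)
    have "\<forall>\<^sub>F k in sequentially. real (Suc k) \<ge> x"
      by (intro eventually_sequentiallyI[of "nat \<lceil>x\<rceil>"]) linarith
    then show "\<forall>\<^sub>F k in sequentially. norm (f x - f (real (Suc k))) \<le> K / (r * x ^ r)"
      by eventually_elim (use bound[OF that] in \<open>simp add: norm_minus_commute[of "f x"]\<close>)
  qed simp
  then show ?thesis by blast
qed

text \<open>The Gaussian is compared with a power only so that the cases \<open>\<alpha> > 0\<close> and \<open>\<alpha> = 0\<close> can share the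
  same convergence and integrability arguments; the exponent \<open>3\<close> leads to the rate \<open>s\<^sup>-\<^sup>2\<close>, which is
  integrable at infinity.\<close>

lemma exp_neg_square_le:
  fixes a s :: real
  assumes "a > 0" "s > 0"
  shows "exp (- a * s\<^sup>2 / 4) \<le> (4 / a + 32 / a\<^sup>2) / s ^ 3"
proof -
  define E where "E = exp (a * s\<^sup>2 / 4)"
  have "E > 0" by (simp add: E_def)
  \<comment> \<open>The Taylor polynomial controls \<open>s\<^sup>2\<close> and \<open>s\<^sup>4\<close>, hence also the odd power in between.\<close>
  have "1 + a * s\<^sup>2 / 4 + (a * s\<^sup>2 / 4)\<^sup>2 / 2 \<le> E"
    unfolding E_def using assms by (intro exp_lower_Taylor_quadratic) simp
  moreover have "0 \<le> a * s\<^sup>2 / 4" "0 \<le> (a * s\<^sup>2 / 4)\<^sup>2 / 2"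
    using assms by auto
  ultimately have "a * s\<^sup>2 / 4 \<le> E" "(a * s\<^sup>2 / 4)\<^sup>2 / 2 \<le> E"
    by linarith+
  then have "s ^ 2 \<le> 4 / a * E" "s ^ 4 \<le> 32 / a\<^sup>2 * E"
    using assms by (auto simp: field_simps eval_nat_numeral)
  moreover have "s ^ 3 \<le> s ^ 2 + s ^ 4"
  proof (cases "s \<le> 1")
    case True
    then have "s ^ 3 \<le> s ^ 2" using assms by (intro power_decreasing) auto
    then show ?thesis using assms by (simp add: add_increasing2)
  next
    case False
    then have "s ^ 3 \<le> s ^ 4" by (intro power_increasing) auto
    then show ?thesis by (simp add: add_increasing)
  qed
  ultimately have "s ^ 3 \<le> (4 / a + 32 / a\<^sup>2) * E"
    by (simp add: distrib_right)
  then have "1 / E \<le> (4 / a + 32 / a\<^sup>2) / s ^ 3"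
    using assms(2) \<open>E > 0\<close> by (simp add: divide_le_eq pos_le_divide_eq mult.commute)
  then show ?thesis
    by (simp add: E_def exp_minus inverse_eq_divide)
qed

section \<open>Integrability and scaling in \<open>L\<^sup>p\<close>\<close>

lemma integrable_powr_tail:
  fixes q :: real
  assumes "q > 1"
  shows "integrable lborel (\<lambda>x::real. (1 + \<bar>x\<bar>) powr - q)"
proof -
  define g where "g x = indicator {0..} x * (1 + x) powr - q" for x :: real
  have "integrable lborel g"
  proof (rule integrableI_nonneg)
    show "g \<in> borel_measurable lborel" unfolding g_def by measurable
    show "AE x in lborel. 0 \<le> g x" by (auto simp: g_def)
    have "(\<integral>\<^sup>+x. ennreal ((1 + x) powr - q) * indicator {0 ..} x \<partial>lborel) =
        ennreal (0 - (1 + 0) powr (1 - q) / (1 - q))"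
    proof (rule nn_integral_FTC_atLeast[where F = "\<lambda>x. (1 + x) powr (1 - q) / (1 - q)"])
      show "((\<lambda>x. (1 + x) powr (1 - q) / (1 - q)) has_real_derivative (1 + x) powr - q) (at x)"
        if "0 \<le> x" for x
      proof -
        have "((\<lambda>x. (1 + x) powr (1 - q)) has_real_derivative (1 - q) * (1 + x) powr - q) (at x)"
          using that by (auto intro!: derivative_eq_intros)
        from DERIV_cdivide[OF this, of "1 - q"] show ?thesis
          using assms by simp
      qed
      have "((\<lambda>x. (1 + x) powr (1 - q)) \<longlongrightarrow> 0) at_top"
        using assms
        by (intro tendsto_neg_powr filterlim_tendsto_add_at_top[OF tendsto_const] filterlim_ident) auto
      then show "((\<lambda>x. (1 + x) powr (1 - q) / (1 - q)) \<longlongrightarrow> 0) at_top"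
        by (rule tendsto_divide_zero)
    qed auto
    moreover have "ennreal (g x) = ennreal ((1 + x) powr - q) * indicator {0 ..} x" for x
      by (auto simp: g_def split: split_indicator)
    ultimately show "(\<integral>\<^sup>+x. ennreal (g x) \<partial>lborel) < \<infinity>"
      by simp
  qed
  then have "integrable lborel (\<lambda>x. g x + g (- x))"
    using lborel_integrable_real_affine[of g "-1" 0] by simp
  then show ?thesis
    by (rule Bochner_Integration.integrable_bound) (auto simp: g_def split: split_indicator)
qed

text \<open>This is the origin of the rate \<open>t powr (1 / (2 p))\<close>, for \<open>a = \<surd>t\<close>.\<close>

lemma Lp_norm_rescale:
  fixes f :: "real \<Rightarrow> 'a::euclidean_space"
  assumes "in_Lp p f" "a > 0"
  shows "in_Lp p (\<lambda>x. f (x / a))" "Lp_norm p (\<lambda>x. f (x / a)) = a powr (1 / p) * Lp_norm p f"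
proof -
  have [measurable]: "f \<in> borel_measurable borel"
    using assms(1) by (simp add: in_Lp_def)
  show "in_Lp p (\<lambda>x. f (x / a))"
    using assms lborel_integrable_real_affine[of "\<lambda>x. norm (f x) powr p" "1 / a" 0]
    by (simp add: in_Lp_def)
  have "(\<integral>x. norm (f (x / a)) powr p \<partial>lborel) = a * (\<integral>x. norm (f x) powr p \<partial>lborel)"
    using lborel_integral_real_affine[of a "\<lambda>x. norm (f (x / a)) powr p" 0] assms(2) by simp
  then show "Lp_norm p (\<lambda>x. f (x / a)) = a powr (1 / p) * Lp_norm p f"
    using assms(2) by (simp add: Lp_norm_def powr_mult)
qed

lemma in_Lp_decay:
  fixes f :: "real \<Rightarrow> 'a::euclidean_space" and p :: real and r :: nat
  assumes meas: "f \<in> borel_measurable lborel"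
    and bounded: "\<And>x. norm (f x) \<le> M"
    and decay: "\<And>x. x \<noteq> 0 \<Longrightarrow> norm (f x) \<le> K / \<bar>x\<bar> ^ r"
    and p: "p > 0" "r * p > 1"
  shows "in_Lp p f"
proof -
  have meas' [measurable]: "f \<in> borel_measurable borel" using meas by simp
  have M: "M \<ge> 0" by (rule order.trans[OF norm_ge_zero bounded[of 0]])
  have K: "K \<ge> 0" using order.trans[OF norm_ge_zero decay[of 1]] by simp
  \<comment> \<open>Both bounds are merged into one that is valid near \<open>0\<close> and at infinity; the factor \<open>2 ^ r\<close>
    comes from \<open>1 + \<bar>x\<bar> \<le> 2 max 1 \<bar>x\<bar>\<close>.\<close>
  define C where "C = (M + K) * 2 ^ r"
  have C: "C \<ge> 0" using M K by (simp add: C_def)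
  have le: "norm (f x) \<le> C / (1 + \<bar>x\<bar>) ^ r" for x
  proof (cases "\<bar>x\<bar> \<le> 1")
    case True
    have "(M + K) * (1 + \<bar>x\<bar>) ^ r \<le> C"
      unfolding C_def using M K True by (intro mult_left_mono power_mono) auto
    then have "M + K \<le> C / (1 + \<bar>x\<bar>) ^ r"
      by (simp add: field_simps)
    with bounded[of x] K show ?thesis by linarith
  next
    case False
    then have "(1 + \<bar>x\<bar>) ^ r \<le> (2 * \<bar>x\<bar>) ^ r"
      by (intro power_mono) auto
    then have "K * (1 + \<bar>x\<bar>) ^ r \<le> (M + K) * (2 * \<bar>x\<bar>) ^ r"
      using M K by (intro mult_mono) auto
    then have "K / \<bar>x\<bar> ^ r \<le> C / (1 + \<bar>x\<bar>) ^ r"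
      using False by (simp add: C_def field_simps power_mult_distrib)
    with decay[of x] False show ?thesis by fastforce
  qed
  have "integrable lborel (\<lambda>x. C powr p * (1 + \<bar>x\<bar>) powr - (r * p))"
    by (intro integrable_mult_right integrable_powr_tail p)
  then have "integrable lborel (\<lambda>x. norm (f x) powr p)"
  proof (rule Bochner_Integration.integrable_bound)
    show "AE x in lborel. norm (norm (f x) powr p) \<le> norm (C powr p * (1 + \<bar>x\<bar>) powr - (r * p))"
    proof (rule AE_I2)
      fix x
      have "norm (f x) powr p \<le> (C / (1 + \<bar>x\<bar>) ^ r) powr p"
        using le p by (intro powr_mono2) auto
      also have "\<dots> = C powr p * (1 + \<bar>x\<bar>) powr - (r * p)"
        using C by (simp add: powr_divide powr_minus_divide powr_powr flip: powr_realpow)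
      finally show "norm (norm (f x) powr p) \<le> norm (C powr p * (1 + \<bar>x\<bar>) powr - (r * p))"
        by simp
    qed
  qed measurable
  with meas show ?thesis by (simp add: in_Lp_def)
qed

section \<open>The profile at infinity\<close>

definition reflect :: "real^3 \<Rightarrow> real^3"
  where "reflect v = vector [v $ 1, - v $ 2, - v $ 3]"

lemma bounded_linear_reflect: "bounded_linear reflect"
  unfolding reflect_def linear_conv_bounded_linear[symmetric]
  by (rule linearI) (simp_all add: vec_eq_iff forall_3)

lemma norm_reflect: "norm (reflect v) = norm v"
  by (simp add: reflect_def norm_vec_def L2_set_def sum_3)

context LLG_profile
begin

lemma converges_rate_damped:
  assumes "\<alpha> > 0"
  shows "\<exists>A K. \<forall>s>0. norm (m s - A) \<le> K / s ^ 2"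
proof -
  define K where "K = c0 * (4 / \<alpha> + 32 / \<alpha>\<^sup>2)"
  have "norm (c s *\<^sub>R n s) \<le> K / s ^ Suc 2" if "s > 0" for s
    using mult_left_mono[OF exp_neg_square_le[OF \<open>\<alpha> > 0\<close> that], of c0] c0 orthonormal(5)
    by (simp add: c_def K_def eval_nat_numeral)
  from converges_with_power_rate[OF D(1) this] show ?thesis
    by (metis divide_divide_eq_left of_nat_numeral zero_less_numeral)
qed

text \<open>Here \<open>m' = c\<^sub>0 n\<close> does not decay, and the convergence comes from oscillation: since
  \<open>b' = - s n / 2\<close>, integration by parts of \<open>c\<^sub>0 n = - 2 c\<^sub>0 b' / s\<close> shows that
  \<open>m + (2 c\<^sub>0 / s) b\<close> has a derivative of size \<open>s\<^sup>-\<^sup>2\<close>.\<close>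

lemma converges_rate_undamped:
  assumes "\<alpha> = 0"
  shows "\<exists>A K. \<forall>s>0. norm (m s - A) \<le> K / s ^ 1"
proof -
  from assms have c: "c = (\<lambda>_. c0)" and \<tau>: "\<tau> = (\<lambda>s. s / 2)"
    by (auto simp: c_def \<tau>_def \<beta>)
  define f where "f s = m s + (2 * c0 / s) *\<^sub>R b s" for s
  have f: "(f has_vector_derivative (- 2 * c0 / s\<^sup>2) *\<^sub>R b s) (at s)" if "s > 0" for s
  proof -
    have "((\<lambda>s. 2 * c0 / s) has_real_derivative - 2 * c0 / s\<^sup>2) (at s)"
      using that by (auto intro!: derivative_eq_intros simp: field_simps power2_eq_square)
    then have "(f has_vector_derivative
        c s *\<^sub>R n s + ((2 * c0 / s) *\<^sub>R (- \<tau> s *\<^sub>R n s) + (- 2 * c0 / s\<^sup>2) *\<^sub>R b s)) (at s)"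
      unfolding f_def by (intro derivative_intros D)
    then show ?thesis
      using that by (simp add: c \<tau>)
  qed
  have "norm ((- 2 * c0 / s\<^sup>2) *\<^sub>R b s) \<le> 2 * c0 / s ^ Suc 1" if "s > 0" for s
    using c0 orthonormal(6) by (simp add: power2_eq_square)
  from converges_with_power_rate[OF f this] obtain A where
    A: "\<And>s. s > 0 \<Longrightarrow> norm (f s - A) \<le> 2 * c0 / s"
    by auto
  have "norm (m s - A) \<le> (4 * c0) / s ^ 1" if "s > 0" for s
  proof -
    have "norm (m s - A) = norm ((f s - A) - (2 * c0 / s) *\<^sub>R b s)"
      by (simp add: f_def algebra_simps)
    also have "\<dots> \<le> 2 * c0 / s + 2 * c0 / s"
      using A[OF that] orthonormal(6) c0 that by (intro norm_triangle_le_diff) simp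
    finally show ?thesis by simp
  qed
  then show ?thesis by blast
qed

text \<open>The curvature is even and the torsion is odd, so reversing the parameter and rotating by \<open>\<pi>\<close>
  about the first axis (with \<open>n\<close> and \<open>b\<close> changing sign) maps the frame to a solution with the
  same initial values.\<close>

lemma m_minus: "m (- s) = reflect (m s)"
proof -
  interpret R: bounded_linear reflect by (rule bounded_linear_reflect)
  have parity: "c (- s) = c s" "\<tau> (- s) = - \<tau> s" for s
    by (simp_all add: c_def \<tau>_def)
  have chain: "((\<lambda>s. reflect (f (- s))) has_vector_derivative reflect (- f')) (at s)"
    if "(f has_vector_derivative f') (at (- s))" for f f' s
    using R.has_vector_derivative[OF vector_diff_chain_at[OF
      has_vector_derivative_minus[OF has_vector_derivative_id] that]]
    by (simp add: o_def)
  have "serret_frenet c \<tau> (\<lambda>s. reflect (m (- s))) (\<lambda>s. - reflect (n (- s))) (\<lambda>s. - reflect (b (- s)))"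
    unfolding serret_frenet_def
  proof (intro allI conjI)
    fix s
    note D' = D[of "- s", THEN chain, unfolded parity]
    show "((\<lambda>s. reflect (m (- s))) has_vector_derivative c s *\<^sub>R - reflect (n (- s))) (at s)"
      using D'(1) by (simp add: R.neg R.scaleR)
    show "((\<lambda>s. - reflect (n (- s))) has_vector_derivative
        - c s *\<^sub>R reflect (m (- s)) + \<tau> s *\<^sub>R - reflect (b (- s))) (at s)"
      using has_vector_derivative_minus[OF D'(2)] by (simp add: R.neg R.scaleR R.add R.diff algebra_simps)
    show "((\<lambda>s. - reflect (b (- s))) has_vector_derivative - \<tau> s *\<^sub>R - reflect (n (- s))) (at s)"
      using has_vector_derivative_minus[OF D'(3)] by (simp add: R.neg R.scaleR)
  qed
  from serret_frenet_unique[OF this frame]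
  have "(\<lambda>s. reflect (m (- s))) = m"
    by (simp add: init) (simp add: reflect_def vec_eq_iff forall_3)
  then have "reflect (m (- (- s))) = m (- s)"
    by (rule fun_cong)
  then show ?thesis by simp
qed

text \<open>For \<open>s \<noteq> 0\<close> the argument \<open>s / \<surd>t\<close> tends to \<open>\<plusminus>\<infinity>\<close> as \<open>t \<rightarrow> 0\<close>, so the pointwise limits and the \<open>L\<^sup>p\<close> bounds
  both follow from the convergence of the profile with a rate, combined with its boundedness
  near \<open>s = 0\<close>.\<close>

lemma initial_trace_and_Lp_rate: "\<exists>Ap \<in> sphere 0 1. \<exists>Am \<in> sphere 0 1.
       (\<forall>s>0. ((\<lambda>t. self_similar c0 \<alpha> s t) \<longlongrightarrow> Ap) (at_right 0)) \<and>
       (\<forall>s<0. ((\<lambda>t. self_similar c0 \<alpha> s t) \<longlongrightarrow> Am) (at_right 0)) \<and>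
       Am = vector [Ap $ 1, - Ap $ 2, - Ap $ 3] \<and>
       (\<forall>p. p > 1 \<or> (p = 1 \<and> \<alpha> > 0) \<longrightarrow>
          (\<exists>C. \<forall>t>0.
             in_Lp p (\<lambda>s. self_similar c0 \<alpha> s t - step_profile Ap Am s) \<and>
             Lp_norm p (\<lambda>s. self_similar c0 \<alpha> s t - step_profile Ap Am s)
               \<le> C * t powr (1 / (2 * p))))"
proof -
  \<comment> \<open>The exponent is the decay rate of the profile. In both cases \<open>r * p > 1\<close> for the admissible \<open>p\<close>.\<close>
  define r :: nat where "r = (if \<alpha> = 0 then 1 else 2)"
  have r: "r > 0" by (simp add: r_def)
  have "\<exists>A K. \<forall>s>0. norm (m s - A) \<le> K / s ^ r"
    using converges_rate_damped converges_rate_undamped \<alpha>(1) by (cases "\<alpha> = 0") (simp_all add: r_def)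
  then obtain A K where AK: "\<And>s. s > 0 \<Longrightarrow> norm (m s - A) \<le> K / s ^ r"
    by blast
  interpret R: bounded_linear reflect by (rule bounded_linear_reflect)
  have AK': "norm (m s - reflect A) \<le> K / \<bar>s\<bar> ^ r" if "s < 0" for s
    using AK[of "- s"] m_minus[of "- s"] that by (simp add: norm_reflect flip: R.diff)
  have lim: "((\<lambda>t. self_similar c0 \<alpha> s t) \<longlongrightarrow> B) (at_right 0)"
    if "\<And>t. t > 0 \<Longrightarrow> norm (m (s / sqrt t) - B) \<le> K / \<bar>s / sqrt t\<bar> ^ r" "s \<noteq> 0" for s B
  proof -
    have "((\<lambda>t. K * (sqrt t / \<bar>s\<bar>) ^ r) \<longlongrightarrow> K * (sqrt 0 / \<bar>s\<bar>) ^ r) (at_right 0)"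
      using \<open>s \<noteq> 0\<close> by (intro tendsto_intros) auto
    then have "((\<lambda>t. K * (sqrt t / \<bar>s\<bar>) ^ r) \<longlongrightarrow> 0) (at_right 0)"
      using r by (simp add: power_0_left)
    moreover have "\<forall>\<^sub>F t in at_right 0. norm (self_similar c0 \<alpha> s t - B) \<le> K * (sqrt t / \<bar>s\<bar>) ^ r"
      using eventually_at_right_less[of "0::real"]
    proof eventually_elim
      case (elim t)
      show ?case
        using that(1)[OF elim] elim by (simp only: self_similar_eq) (simp add: power_divide)
    qed
    ultimately have "((\<lambda>t. self_similar c0 \<alpha> s t - B) \<longlongrightarrow> 0) (at_right 0)"
      by (rule Lim_null_comparison[rotated])
    then show ?thesis
      by (rule LIM_zero_cancel)
  qed
  have lim_pos: "((\<lambda>t. self_similar c0 \<alpha> s t) \<longlongrightarrow> A) (at_right 0)" if "s > 0" for s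
    using AK[of "s / sqrt _"] that by (intro lim) auto
  have lim_neg: "((\<lambda>t. self_similar c0 \<alpha> s t) \<longlongrightarrow> reflect A) (at_right 0)" if "s < 0" for s
    using AK'[of "s / sqrt _"] that by (intro lim) (auto simp: divide_less_0_iff)
  have nA: "norm A = 1"
    using tendsto_norm[OF lim_pos[of 1]] orthonormal(4)
    by (simp add: self_similar_eq tendsto_const_iff)
  define f where "f s = m s - step_profile A (reflect A) s" for s
  \<comment> \<open>The step function is invariant under dilations, so the error at time \<open>t\<close> is a dilation of a
    single function.\<close>
  have fss: "(\<lambda>s. self_similar c0 \<alpha> s t - step_profile A (reflect A) s) = (\<lambda>s. f (s / sqrt t))"
    if "t > 0" for t
    using that by (auto simp: fun_eq_iff f_def self_similar_eq step_profile_def zero_less_divide_iff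
        divide_less_0_iff split: split_indicator)
  have f: "in_Lp p f" if p: "p > 1 \<or> (p = 1 \<and> \<alpha> > 0)" for p
  proof (rule in_Lp_decay)
    have [measurable]: "m \<in> borel_measurable borel"
      using smooth_continuous_on[OF smooth_m, of UNIV 0] by (intro borel_measurable_continuous_onI) simp
    show "f \<in> borel_measurable lborel"
      unfolding f_def step_profile_def by measurable
    show "norm (f x) \<le> 2" for x
      using norm_triangle_ineq4[of "m x" A] norm_triangle_ineq4[of "m x" "reflect A"] orthonormal(4)[of x] nA
      by (auto simp: f_def step_profile_def norm_reflect split: split_indicator)
    show "norm (f x) \<le> K / \<bar>x\<bar> ^ r" if "x \<noteq> 0" for x
      using that AK[of x] AK'[of x] by (cases "x > 0") (auto simp: f_def step_profile_def)
    show "p > 0" "real r * p > 1"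
      using p by (auto simp: r_def)
  qed
  have "in_Lp p (\<lambda>s. f (s / sqrt t)) \<and> Lp_norm p (\<lambda>s. f (s / sqrt t)) \<le> Lp_norm p f * t powr (1 / (2 * p))"
    if "p > 1 \<or> (p = 1 \<and> \<alpha> > 0)" "t > 0" for p t
  proof -
    have "sqrt t powr (1 / p) = t powr (1 / (2 * p))"
      using powr_powr[of t "1 / 2" "1 / p"] powr_half_sqrt[of t] \<open>t > 0\<close> by simp
    then show ?thesis
      using Lp_norm_rescale[OF f[OF that(1)], of "sqrt t"] \<open>t > 0\<close> by (simp add: mult.commute)
  qed
  note Lp = this
  show ?thesis
  proof (rule bexI[of _ A], rule bexI[of _ "reflect A"], intro conjI allI impI)
    show "reflect A = vector [A $ 1, - A $ 2, - A $ 3]"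
      by (rule reflect_def)
    show "\<exists>C. \<forall>t>0. in_Lp p (\<lambda>s. self_similar c0 \<alpha> s t - step_profile A (reflect A) s) \<and>
        Lp_norm p (\<lambda>s. self_similar c0 \<alpha> s t - step_profile A (reflect A) s) \<le> C * t powr (1 / (2 * p))"
      if "p > 1 \<or> (p = 1 \<and> \<alpha> > 0)" for p
    proof (intro exI[of _ "Lp_norm p f"] allI impI)
      fix t :: real assume "t > 0"
      from Lp[OF that this]
      show "in_Lp p (\<lambda>s. self_similar c0 \<alpha> s t - step_profile A (reflect A) s) \<and>
          Lp_norm p (\<lambda>s. self_similar c0 \<alpha> s t - step_profile A (reflect A) s)
            \<le> Lp_norm p f * t powr (1 / (2 * p))"
        unfolding fss[OF \<open>t > 0\<close>] .
    qed
  qed (use lim_pos lim_neg nA in \<open>simp_all add: norm_reflect\<close>)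
qed

end

section \<open>The initial value problem with a jump\<close>

theorem theorem1p1:
  fixes \<alpha> \<beta> c0 :: real
  assumes "\<alpha> \<in> {0..1}" and "\<beta> = sqrt (1 - \<alpha>\<^sup>2)" and "c0 > 0"
  shows "regular_LLG_solution \<alpha> \<beta> (self_similar c0 \<alpha>) \<and>
    (\<exists>Ap \<in> sphere 0 1. \<exists>Am \<in> sphere 0 1.
       (\<forall>s>0. ((\<lambda>t. self_similar c0 \<alpha> s t) \<longlongrightarrow> Ap) (at_right 0)) \<and>
       (\<forall>s<0. ((\<lambda>t. self_similar c0 \<alpha> s t) \<longlongrightarrow> Am) (at_right 0)) \<and>
       Am = vector [Ap $ 1, - Ap $ 2, - Ap $ 3] \<and>
       (\<forall>p. p > 1 \<or> (p = 1 \<and> \<alpha> > 0) \<longrightarrow>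
          (\<exists>C. \<forall>t>0.
             in_Lp p (\<lambda>s. self_similar c0 \<alpha> s t - step_profile Ap Am s) \<and>
             Lp_norm p (\<lambda>s. self_similar c0 \<alpha> s t - step_profile Ap Am s)
               \<le> C * t powr (1 / (2 * p)))))"
proof -
  have "continuous_on UNIV (\<lambda>s. c0 * exp (- \<alpha> * s\<^sup>2 / 4))" "continuous_on UNIV (\<lambda>s. \<beta> * s / 2)"
    by (intro continuous_intros; simp)+
  from serret_frenet_exists[OF this] obtain m n b where
    "serret_frenet (\<lambda>s. c0 * exp (- \<alpha> * s\<^sup>2 / 4)) (\<lambda>s. \<beta> * s / 2) m n b"
    "m 0 = vector [1, 0, 0]" "n 0 = vector [0, 1, 0]" "b 0 = vector [0, 0, 1]"
    by blast
  then interpret LLG_profile c0 \<alpha> \<beta> "\<lambda>s. c0 * exp (- \<alpha> * s\<^sup>2 / 4)" "\<lambda>s. \<beta> * s / 2" m n b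
    using assms by unfold_locales auto
  show ?thesis
    using regular_solution initial_trace_and_Lp_rate by (rule conjI)
qed

end
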